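(* Let $H$ be a real Hilbert space, $A\colon H\to2^H$ a maximal monotone operator with $\operatorname{zer}A\neq\emptyset$, and $M\colon H\to H$ a bounded linear self-adjoint positive semidefinite operator such that $(M+A)^{-1}$ is Lipschitz over $\operatorname{Im}M$ and $J_{M^{-1}A}=(M+A)^{-1}M$ has full domain. Let $(u^k)_{k\in\mathbb N}$ be a sequence in $H$, and suppose that: (i) for all $u^*\in\operatorname{Fix}J_{M^{-1}A}$ the limit $\lim_{k\to+\infty}\|u^k-u^*\|_M$ exists; (ii) $\lim_{k\to+\infty}\|u^k-J_{M^{-1}A}(u^k)\|_M=0$. Then there is $u^*\in\operatorname{zer}A$ such that $J_{M^{-1}A}(u^k)\rightharpoonup u^*$ as $k\to+\infty$. If, additionally, $M$ has closed range and $M=CC^*$ is an onto decomposition with $C\colon D\to H$, then for $w^k:=C^*u^k$ there is $w^*\in\operatorname{zer}(C^*\rhd A)$ such that $$w^k\rightharpoonup w^*\quad\text{and}\quad(A+M)^{-1}(Cw^k)=J_{M^{-1}A}(u^k)\rightharpoonup u^*\in\operatorname{zer}A\quad\text{as }k\to+\infty.$$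
   Context: For a set-valued operator $A\colon H\to2^H$, $\operatorname{zer}A:=\{u:0\in A(u)\}$; $A$ is maximal monotone if its graph is maximal (for inclusion) among graphs of monotone operators; $A^{-1}$ is the set-valued inverse; $\operatorname{Fix}$ denotes the set of fixed points; $\rightharpoonup$ is weak convergence. The operator $M$ may be degenerate ($\ker M\ne\{0\}$); it induces the semi-inner product $\langle u,v\rangle_M:=\langle u,Mv\rangle$ and the seminorm $\|u\|_M:=\sqrt{\langle u,u\rangle_M}$. The operator $M^{-1}A$ is defined by: $v\in M^{-1}A(u)$ if and only if $Mv\in A(u)$; its resolvent is $J_{M^{-1}A}:=(I+M^{-1}A)^{-1}=(M+A)^{-1}M$. "$(M+A)^{-1}$ is Lipschitz over $\operatorname{Im}M$" means there is $L\ge 0$ with $\|v-v'\|\le L\|p-p'\|$ whenever $p,p'\in\operatorname{Im}M$, $v\in(M+A)^{-1}(p)$, $v'\in(M+A)^{-1}(p')$ (so it is single-valued there); hence $J_{M^{-1}A}$ is a single-valued Lipschitz map on $H$. When $M$ has closed range, an onto decomposition $M=CC^*$ consists of a real Hilbert space $D$ and an injective bounded linear operator $C\colon D\to H$ with $M=CC^*$ (in which case $C^*\colon H\to D$ is surjective). The operator $C^*\rhd A\colon D\to2^D$ is $C^*\rhd A:=(C^*A^{-1}C)^{-1}$. *)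

theory Defs
  imports "HOL-Analysis.Analysis"
begin

text \<open>
  Real Hilbert spaces are the types of sort \<open>{real_inner, complete_space}\<close>, and a set-valued
  operator is a function into sets. The Hilbert adjoint is the library constant \<open>adjoint\<close>. It is
  a choice among the maps \<open>g\<close> with \<open>f x \<bullet> y = x \<bullet> g y\<close>; for bounded linear \<open>f\<close> on a Hilbert
  space there is exactly one, by the Riesz representation theorem.
\<close>

type_synonym 'a setop = "'a \<Rightarrow> 'a set"

definition op_graph :: "('a \<Rightarrow> 'b set) \<Rightarrow> ('a \<times> 'b) set" where
  "op_graph A = {(x, p). p \<in> A x}"

definition op_inverse :: "('a \<Rightarrow> 'b set) \<Rightarrow> 'b \<Rightarrow> 'a set" where
  "op_inverse A p = {x. p \<in> A x}"

definition op_domain :: "('a \<Rightarrow> 'b set) \<Rightarrow> 'a set" where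
  "op_domain A = {x. A x \<noteq> {}}"

definition zer :: "('a \<Rightarrow> 'b::zero set) \<Rightarrow> 'a set" where
  "zer A = {x. 0 \<in> A x}"

definition op_of :: "('a \<Rightarrow> 'b) \<Rightarrow> 'a \<Rightarrow> 'b set" where
  "op_of f x = {f x}"

definition op_plus :: "('a \<Rightarrow> 'b::plus set) \<Rightarrow> ('a \<Rightarrow> 'b set) \<Rightarrow> 'a \<Rightarrow> 'b set" where
  "op_plus A B x = {p + q | p q. p \<in> A x \<and> q \<in> B x}"

definition monotone_operator :: "'a::real_inner setop \<Rightarrow> bool" where
  "monotone_operator A \<longleftrightarrow>
     (\<forall>x y. \<forall>p\<in>A x. \<forall>q\<in>A y. (x - y) \<bullet> (p - q) \<ge> 0)"

definition maximal_monotone :: "'a::real_inner setop \<Rightarrow> bool" where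
  "maximal_monotone A \<longleftrightarrow> monotone_operator A \<and>
     (\<forall>B. monotone_operator B \<and> op_graph A \<subseteq> op_graph B \<longrightarrow> op_graph B = op_graph A)"

definition M_seminorm :: "('a::real_inner \<Rightarrow> 'a) \<Rightarrow> 'a \<Rightarrow> real" where
  "M_seminorm M x = sqrt (x \<bullet> M x)"

text \<open>\<open>precond M A\<close> is $M^{-1}A$; \<open>M\<close> need not be invertible.\<close>

definition precond :: "('a \<Rightarrow> 'a) \<Rightarrow> 'a setop \<Rightarrow> 'a setop" where
  "precond M A x = {v. M v \<in> A x}"

definition resolvent :: "'a::real_inner setop \<Rightarrow> 'a setop" where
  "resolvent B = op_inverse (op_plus (op_of (\<lambda>x. x)) B)"

lemma resolvent_precond:
  assumes "linear M"
  shows "resolvent (precond M A) = (\<lambda>x. op_inverse (op_plus (op_of M) A) (M x))"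
proof (intro ext set_eqI)
  fix x v
  have "v \<in> resolvent (precond M A) x \<longleftrightarrow> M (x - v) \<in> A v"
    by (auto simp: resolvent_def precond_def op_inverse_def op_plus_def op_of_def
        intro!: exI[of _ "x - v"])
  also have "\<dots> \<longleftrightarrow> v \<in> op_inverse (op_plus (op_of M) A) (M x)"
    using assms
    by (auto simp: op_inverse_def op_plus_def op_of_def linear_diff
        intro!: exI[of _ "M x - M v"])
  finally show "v \<in> resolvent (precond M A) x \<longleftrightarrow>
      v \<in> op_inverse (op_plus (op_of M) A) (M x)" .
qed

definition op_lipschitz_on :: "('b::real_normed_vector \<Rightarrow> 'a::real_normed_vector set) \<Rightarrow> 'b set \<Rightarrow> bool" where
  "op_lipschitz_on B S \<longleftrightarrow>
     (\<exists>L\<ge>0. \<forall>p\<in>S. \<forall>p'\<in>S. \<forall>v\<in>B p. \<forall>v'\<in>B p'. norm (v - v') \<le> L * norm (p - p'))"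

text \<open>
  The map underlying $J_{M^{-1}A}$. It is meaningful only where the resolvent is single-valued,
  which \<open>resolvent_eq_resolvent_map\<close> below establishes under the standing assumptions.
\<close>

definition resolvent_map :: "('a::real_inner \<Rightarrow> 'a) \<Rightarrow> 'a setop \<Rightarrow> 'a \<Rightarrow> 'a" where
  "resolvent_map M A x = the_elem (resolvent (precond M A) x)"

lemma resolvent_eq_resolvent_map:
  assumes "linear M"
    and lip: "op_lipschitz_on (op_inverse (op_plus (op_of M) A)) (range M)"
    and dom: "op_domain (resolvent (precond M A)) = UNIV"
  shows "resolvent (precond M A) x = {resolvent_map M A x}"
proof -
  have single: "v = v'"
    if "v \<in> resolvent (precond M A) x" "v' \<in> resolvent (precond M A) x" for v v'
  proof -
    obtain L where "\<forall>p\<in>range M. \<forall>p'\<in>range M.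
        \<forall>v\<in>op_inverse (op_plus (op_of M) A) p. \<forall>v'\<in>op_inverse (op_plus (op_of M) A) p'.
          norm (v - v') \<le> L * norm (p - p')"
      using lip unfolding op_lipschitz_on_def by blast
    then have "norm (v - v') \<le> L * norm (M x - M x)"
      using that unfolding resolvent_precond[OF assms(1)] by blast
    then show ?thesis by simp
  qed
  obtain v where "v \<in> resolvent (precond M A) x"
    using dom unfolding op_domain_def by blast
  with single have "resolvent (precond M A) x = {v}" by blast
  then show ?thesis by (simp add: resolvent_map_def)
qed

definition Fix :: "('a \<Rightarrow> 'a) \<Rightarrow> 'a set" where
  "Fix T = {x. T x = x}"

definition weakly_converges :: "(nat \<Rightarrow> 'a::real_normed_vector) \<Rightarrow> 'a \<Rightarrow> bool" where
  "weakly_converges x l \<longleftrightarrow>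
     (\<forall>f::'a \<Rightarrow> real. bounded_linear f \<longrightarrow> (\<lambda>k. f (x k)) \<longlonglongrightarrow> f l)"

definition onto_decomposition :: "('a::real_inner \<Rightarrow> 'a) \<Rightarrow> ('d::real_inner \<Rightarrow> 'a) \<Rightarrow> bool" where
  "onto_decomposition M C \<longleftrightarrow> bounded_linear C \<and> inj C \<and> M = C \<circ> adjoint C"

text \<open>\<open>adj_pushforward C A\<close> is $C^* \rhd A = (C^* A^{-1} C)^{-1}$.\<close>

definition adj_pushforward :: "('d::real_inner \<Rightarrow> 'a::real_inner) \<Rightarrow> 'a setop \<Rightarrow> 'd setop" where
  "adj_pushforward C A = op_inverse (\<lambda>d. adjoint C ` op_inverse A (C d))"

end

theory Submission
  imports Defs
begin

text \<open>
  Write \<open>T\<close> for the resolvent map and \<open>v k = T (u k)\<close>. The argument is that of Opial, carried out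
  in the seminorm of \<open>M\<close> for the shadow sequence \<open>v\<close> rather than for \<open>u\<close>, which may be unbounded
  along the kernel of \<open>M\<close>.

  Since the inverse of \<open>M + A\<close> is Lipschitz over the range of \<open>M\<close>, the map \<open>T\<close> satisfies
  \<open>norm (T x - T y) \<le> L * norm (M x - M y)\<close>, and positivity of \<open>M\<close> bounds \<open>norm (M x)\<close> by a
  multiple of the seminorm of \<open>x\<close> (\<open>norm_psd_le_M_seminorm\<close>). Hence \<open>v\<close> is bounded although \<open>u\<close>
  is controlled only in the seminorm, and \<open>M (u k - v k)\<close>, which lies in \<open>A (v k)\<close>, tends to zero
  in norm.

  A bounded sequence has weak cluster points. Each of them is a zero of \<open>A\<close>, because the graph of
  a maximal monotone operator is closed for bounded weak convergence in the domain and norm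
  convergence in the range (\<open>maximal_monotone_demiclosed\<close>). If \<open>x\<close> and \<open>y\<close> are two cluster points, expanding
  the convergent squared seminorms of \<open>u k - x\<close> and \<open>u k - y\<close> shows that \<open>u k \<bullet> M (x - y)\<close>
  converges (\<open>convergent_inner_M_diff\<close>), and so does \<open>v k \<bullet> M (x - y)\<close>. Evaluating the limit along
  both cluster filters gives \<open>(x - y) \<bullet> M (x - y) = 0\<close>, hence \<open>M x = M y\<close>. The seminorm cannot
  separate such points, but \<open>T\<close> can: both are fixed points of \<open>T\<close>, and \<open>T\<close> depends on its
  argument only through \<open>M\<close>, so \<open>x = y\<close>. A bounded sequence with a single weak cluster point
  converges weakly to it.

  For a decomposition \<open>M = C C\<^sup>*\<close> one has \<open>norm (C\<^sup>* x) = M_seminorm M x\<close>. Thus \<open>C\<^sup>* (u k)\<close> differs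
  from \<open>C\<^sup>* (v k)\<close> by a sequence tending to zero in norm, and it converges weakly to the image under
  \<open>C\<^sup>*\<close> of the weak limit of \<open>v\<close>; the zeros of \<open>C\<^sup>* \<rhd> A\<close> are exactly the images of the zeros
  of \<open>A\<close> under \<open>C\<^sup>*\<close>.
\<close>

section \<open>Riesz representation and adjoints\<close>

text \<open>
  The representing vector minimises \<open>y \<bullet> y - 2 * f y\<close>, whose stationarity condition is
  \<open>f z = x \<bullet> z\<close>. By the parallelogram law every minimising sequence is Cauchy.
\<close>

theorem riesz_representation:
  fixes f :: "'a::{real_inner, complete_space} \<Rightarrow> real"
  assumes "bounded_linear f"
  obtains x where "\<And>y. f y = x \<bullet> y"
proof -
  interpret bounded_linear f by fact
  obtain K where K: "\<And>y. \<bar>f y\<bar> \<le> norm y * K"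
    using bounded by auto
  define \<phi> where "\<phi> y = y \<bullet> y - 2 * f y" for y
  have "\<phi> y \<ge> - K\<^sup>2" for y
  proof -
    have "0 \<le> (norm y - K)\<^sup>2" by simp
    then have "- K\<^sup>2 \<le> (norm y)\<^sup>2 - 2 * (norm y * K)"
      by (simp add: power2_diff algebra_simps)
    also have "\<dots> \<le> \<phi> y"
      using K[of y] by (simp add: \<phi>_def power2_norm_eq_inner)
    finally show ?thesis .
  qed
  then have bdd: "bdd_below (range \<phi>)" by (intro bdd_belowI[of _ "- K\<^sup>2"]) auto
  define m where "m = Inf (range \<phi>)"
  have m_le: "m \<le> \<phi> y" for y
    unfolding m_def using bdd by (simp add: cInf_lower)
  have "\<exists>y. \<phi> y < m + inverse (real (Suc n))" for n
    using cInf_lessD[of "range \<phi>" "m + inverse (real (Suc n))"] by (auto simp: m_def)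
  then obtain y where y: "\<And>n. \<phi> (y n) < m + inverse (real (Suc n))"
    by metis
  have parallelogram: "(norm (a - b))\<^sup>2 \<le> 2 * (\<phi> a - m) + 2 * (\<phi> b - m)" for a b
  proof -
    have "(norm (a - b))\<^sup>2 = 2 * \<phi> a + 2 * \<phi> b - 4 * \<phi> ((1/2) *\<^sub>R (a + b))"
      by (simp add: \<phi>_def power2_norm_eq_inner inner_diff inner_add scale add
          inner_commute algebra_simps)
    with m_le[of "(1/2) *\<^sub>R (a + b)"] show ?thesis by simp
  qed
  have "Cauchy y"
  proof (rule metric_CauchyI)
    fix e :: real
    assume "e > 0"
    then obtain N where N: "inverse (real (Suc N)) < e\<^sup>2 / 4"
      using reals_Archimedean[of "e\<^sup>2 / 4"] by auto
    have small: "4 * (\<phi> (y n) - m) < e\<^sup>2" if "n \<ge> N" for n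
    proof -
      have "inverse (real (Suc n)) \<le> inverse (real (Suc N))"
        using that by (simp add: le_imp_inverse_le)
      then have "\<phi> (y n) - m < e\<^sup>2 / 4" using y[of n] N by linarith
      then show ?thesis by simp
    qed
    have "dist (y i) (y j) < e" if "i \<ge> N" "j \<ge> N" for i j
    proof -
      have "(norm (y i - y j))\<^sup>2 < e\<^sup>2"
        using parallelogram[of "y i" "y j"] small[OF that(1)] small[OF that(2)] by linarith
      then show ?thesis
        using \<open>e > 0\<close> by (simp add: dist_norm power_less_imp_less_base)
    qed
    then show "\<exists>N. \<forall>i\<ge>N. \<forall>j\<ge>N. dist (y i) (y j) < e" by blast
  qed
  then obtain x where x: "y \<longlonglongrightarrow> x"
    using Cauchy_convergent_iff convergent_def by blast
  have "(\<lambda>n. \<phi> (y n)) \<longlonglongrightarrow> \<phi> x"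
    unfolding \<phi>_def by (intro tendsto_intros tendsto x)
  moreover have "(\<lambda>n. m + inverse (real (Suc n))) \<longlonglongrightarrow> m + 0"
    by (intro tendsto_intros LIMSEQ_inverse_real_of_nat)
  ultimately have "\<phi> x \<le> m + 0"
    using y by (intro LIMSEQ_le[of _ _ "\<lambda>n. m + inverse (real (Suc n))"]) (auto intro: less_imp_le)
  with m_le have min: "\<phi> x \<le> \<phi> z" for z
    by (metis add.right_neutral order_trans)
  have "f z = x \<bullet> z" for z
  proof (cases "z = 0")
    case False
    define c where "c = x \<bullet> z - f z"
    \<comment> \<open>The step along \<open>z\<close> that lowers \<open>\<phi>\<close> most, by \<open>c\<^sup>2 / (z \<bullet> z)\<close>.\<close>
    define t where "t = - c / (z \<bullet> z)"
    have "0 \<le> \<phi> (x + t *\<^sub>R z) - \<phi> x" using min by simp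
    also have "\<dots> = 2 * t * c + t * t * (z \<bullet> z)"
      by (simp add: \<phi>_def c_def inner_add add scale inner_commute algebra_simps)
    also have "\<dots> = - c\<^sup>2 / (z \<bullet> z)"
      using False by (simp add: t_def field_simps power2_eq_square)
    finally have "0 \<le> - c\<^sup>2 / (z \<bullet> z)" .
    moreover have "0 < z \<bullet> z" using False by simp
    ultimately have "c\<^sup>2 \<le> 0"
      by (metis divide_neg_pos leD leI neg_less_0_iff_less)
    then show ?thesis by (simp add: c_def)
  qed (simp add: zero)
  then show thesis by (rule that)
qed

text \<open>
  The constant \<^const>\<open>adjoint\<close> is a choice, which has the adjoint property as soon as some map does;
  on a Hilbert space the Riesz representation theorem supplies one.
\<close>

lemma inner_adjoint:
  fixes f :: "'a::{real_inner, complete_space} \<Rightarrow> 'b::real_inner"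
  assumes "bounded_linear f"
  shows "x \<bullet> adjoint f y = f x \<bullet> y"
proof -
  have "\<exists>z. \<forall>x. f x \<bullet> y = z \<bullet> x" for y
    using riesz_representation[OF bounded_linear_compose[OF bounded_linear_inner_left assms]]
    by metis
  then obtain g where "\<And>x y. f x \<bullet> y = g y \<bullet> x" by metis
  then have "\<exists>g. \<forall>x y. f x \<bullet> y = x \<bullet> g y"
    by (auto simp: inner_commute)
  then have "\<forall>x y. f x \<bullet> y = x \<bullet> adjoint f y"
    unfolding adjoint_def by (rule someI_ex)
  then show ?thesis by simp
qed

lemma bounded_linear_adjoint:
  fixes f :: "'a::{real_inner, complete_space} \<Rightarrow> 'b::real_inner"
  assumes "bounded_linear f"
  shows "bounded_linear (adjoint f)"
proof -
  interpret bounded_linear f by fact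
  obtain K where K: "\<And>x. norm (f x) \<le> norm x * K" "K \<ge> 0"
    using nonneg_bounded by auto
  show ?thesis
  proof (rule bounded_linear_intro)
    show "adjoint f (x + y) = adjoint f x + adjoint f y" for x y
      by (rule vector_eq_ldot[THEN iffD1])
        (simp add: inner_adjoint[OF assms] inner_add)
    show "adjoint f (r *\<^sub>R x) = r *\<^sub>R adjoint f x" for r x
      by (rule vector_eq_ldot[THEN iffD1])
        (simp add: inner_adjoint[OF assms])
    fix y
    have "(norm (adjoint f y))\<^sup>2 = f (adjoint f y) \<bullet> y"
      by (simp add: power2_norm_eq_inner inner_adjoint[OF assms])
    also have "\<dots> \<le> norm (f (adjoint f y)) * norm y" by (rule norm_cauchy_schwarz)
    also have "\<dots> \<le> norm (adjoint f y) * (norm y * K)"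
      using mult_right_mono[OF K(1)[of "adjoint f y"], of "norm y"] by (simp add: mult_ac)
    finally show "norm (adjoint f y) \<le> norm y * K"
      using K(2) by (cases "adjoint f y = 0") (simp_all add: power2_eq_square)
  qed
qed

section \<open>Weak convergence\<close>

lemma weakly_converges_iff_inner:
  fixes x :: "nat \<Rightarrow> 'a::{real_inner, complete_space}"
  shows "weakly_converges x l \<longleftrightarrow> (\<forall>y. (\<lambda>k. x k \<bullet> y) \<longlonglongrightarrow> l \<bullet> y)"
proof
  assume "weakly_converges x l"
  then show "\<forall>y. (\<lambda>k. x k \<bullet> y) \<longlonglongrightarrow> l \<bullet> y"
    unfolding weakly_converges_def using bounded_linear_inner_left by blast
next
  assume inner: "\<forall>y. (\<lambda>k. x k \<bullet> y) \<longlonglongrightarrow> l \<bullet> y"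
  have "(\<lambda>k. f (x k)) \<longlonglongrightarrow> f l" if "bounded_linear f" for f :: "'a \<Rightarrow> real"
    using riesz_representation[OF that] inner by (metis (no_types, lifting) ext inner_commute)
  then show "weakly_converges x l" by (simp add: weakly_converges_def)
qed

lemma weakly_converges_bounded_linear:
  assumes "bounded_linear T" "weakly_converges x l"
  shows "weakly_converges (\<lambda>k. T (x k)) (T l)"
  using assms bounded_linear_compose[OF _ assms(1)]
  unfolding weakly_converges_def by blast

lemma weakly_converges_diff_tendsto_zero:
  assumes "weakly_converges y l" "(\<lambda>k. x k - y k) \<longlonglongrightarrow> 0"
  shows "weakly_converges x l"
  unfolding weakly_converges_def
proof (intro allI impI)
  fix f :: "'a \<Rightarrow> real"
  assume f: "bounded_linear f"
  have "(\<lambda>k. f (x k - y k)) \<longlonglongrightarrow> f 0"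
    using assms(2) by (rule bounded_linear.tendsto[OF f])
  moreover have "(\<lambda>k. f (y k)) \<longlonglongrightarrow> f l"
    using assms(1) f by (simp add: weakly_converges_def)
  ultimately have "(\<lambda>k. f (x k - y k) + f (y k)) \<longlonglongrightarrow> f 0 + f l"
    by (rule tendsto_add)
  then show "(\<lambda>k. f (x k)) \<longlonglongrightarrow> f l"
    by (simp add: linear_diff[OF bounded_linear.linear[OF f]] linear_0[OF bounded_linear.linear[OF f]])
qed

text \<open>
  Weak compactness of balls, in a form that also holds in non-separable spaces without extracting
  subsequences. The functionals \<open>y \<mapsto> v i \<bullet> y\<close> lie in a product of compact intervals, which is
  compact by Tychonoff's theorem; so they cluster pointwise at some \<open>g\<close>, along a filter \<open>G\<close> finer
  than \<open>F\<close>. Such a \<open>g\<close> is again linear and bounded, and is represented by a vector.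
\<close>

lemma bounded_weak_cluster_point:
  fixes v :: "'i \<Rightarrow> 'a::{real_inner, complete_space}"
  assumes "F \<noteq> bot" and B: "\<And>i. norm (v i) \<le> B"
  obtains G x where "G \<noteq> bot" "G \<le> F" "\<And>y. ((\<lambda>i. v i \<bullet> y) \<longlongrightarrow> x \<bullet> y) G"
proof -
  define \<Phi> where "\<Phi> i = (\<lambda>y. v i \<bullet> y)" for i
  define K where "K = (PiE UNIV (\<lambda>y. {- (B * norm y)..B * norm y}) :: ('a \<Rightarrow> real) set)"
  have "compact K"
    unfolding K_def
    by (subst compactin_euclidean_iff[symmetric], subst euclidean_product_topology[symmetric])
      (simp add: compactin_PiE)
  have \<Phi>_K: "\<Phi> i \<in> K" for i
  proof -
    have "\<bar>v i \<bullet> y\<bar> \<le> B * norm y" for y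
      using Cauchy_Schwarz_ineq2[of "v i" y] mult_right_mono[OF B[of i], of "norm y"] by simp
    then show ?thesis by (auto simp: \<Phi>_def K_def PiE_iff abs_le_iff minus_le_iff)
  qed
  obtain g where "g \<in> K" and g: "inf (nhds g) (filtermap \<Phi> F) \<noteq> bot"
    using \<open>compact K\<close> \<Phi>_K \<open>F \<noteq> bot\<close> unfolding compact_filter
    by (metis (mono_tags, lifting) always_eventually eventually_filtermap filtermap_bot_iff)
  \<comment> \<open>The coarsest filter finer than \<open>F\<close> along which \<open>\<Phi>\<close> converges to \<open>g\<close>.\<close>
  define G where "G = inf (filtercomap \<Phi> (nhds g)) F"
  have "G \<noteq> bot"
  proof
    assume "G = bot"
    then have "eventually (\<lambda>_. False) G" by simp
    then obtain P Q where P: "eventually P (nhds g)" and Q: "eventually Q F"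
        and PQ: "\<And>i. P (\<Phi> i) \<Longrightarrow> Q i \<Longrightarrow> False"
      unfolding G_def eventually_inf eventually_filtercomap by blast
    have "eventually (\<lambda>h. \<not> P h) (filtermap \<Phi> F)"
      unfolding eventually_filtermap using Q by (rule eventually_mono) (use PQ in blast)
    with P have "eventually (\<lambda>_. False) (inf (nhds g) (filtermap \<Phi> F))"
      unfolding eventually_inf by blast
    with g show False by (simp add: trivial_limit_def)
  qed
  have "filterlim \<Phi> (nhds g) G"
    unfolding G_def filterlim_iff_le_filtercomap by simp
  then have lim: "((\<lambda>i. v i \<bullet> y) \<longlongrightarrow> g y) G" for y
    using continuous_on_tendsto_compose[OF continuous_on_product_coordinates, of \<Phi> g G y]
    by (simp add: \<Phi>_def)
  have "bounded_linear g"
  proof (rule bounded_linear_intro)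
    show "g (a + b) = g a + g b" for a b
      using tendsto_unique[OF \<open>G \<noteq> bot\<close> lim[of "a + b"]] tendsto_add[OF lim[of a] lim[of b]]
      by (simp add: inner_add)
    show "g (r *\<^sub>R a) = r *\<^sub>R g a" for r a
      using tendsto_unique[OF \<open>G \<noteq> bot\<close> lim[of "r *\<^sub>R a"]] tendsto_mult_left[OF lim[of a], of r]
      by simp
    show "norm (g a) \<le> norm a * B" for a
      using \<open>g \<in> K\<close> by (auto simp: K_def PiE_iff abs_le_iff minus_le_iff mult.commute[of _ B])
  qed
  then obtain x where "\<And>y. g y = x \<bullet> y" by (rule riesz_representation) blast
  with lim have "\<And>y. ((\<lambda>i. v i \<bullet> y) \<longlongrightarrow> x \<bullet> y) G" by simp
  moreover have "G \<le> F" by (simp add: G_def)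
  ultimately show thesis using that \<open>G \<noteq> bot\<close> by blast
qed

text \<open>
  If weak convergence to \<open>l\<close> failed, some open set would be avoided frequently by \<open>v k \<bullet> y\<close>;
  a cluster point along the indices where it is avoided could not be \<open>l\<close>.
\<close>

lemma weakly_converges_if_unique_cluster_point:
  fixes v :: "nat \<Rightarrow> 'a::{real_inner, complete_space}"
  assumes B: "\<And>k. norm (v k) \<le> B"
    and unique: "\<And>G x. G \<noteq> bot \<Longrightarrow> G \<le> sequentially \<Longrightarrow>
          (\<And>y. ((\<lambda>k. v k \<bullet> y) \<longlongrightarrow> x \<bullet> y) G) \<Longrightarrow> x = l"
  shows "weakly_converges v l"
proof -
  have "(\<lambda>k. v k \<bullet> y) \<longlonglongrightarrow> l \<bullet> y" for y
  proof (rule ccontr)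
    assume "\<not> (\<lambda>k. v k \<bullet> y) \<longlonglongrightarrow> l \<bullet> y"
    then obtain S where S: "open S" "l \<bullet> y \<in> S"
        and nev: "\<not> eventually (\<lambda>k. v k \<bullet> y \<in> S) sequentially"
      unfolding tendsto_def by blast
    define F where "F = inf sequentially (principal {k. v k \<bullet> y \<notin> S})"
    have "F \<noteq> bot"
      using nev by (simp add: F_def trivial_limit_def eventually_inf_principal)
    then obtain G x where G: "G \<noteq> bot" "G \<le> F" and x: "\<And>y. ((\<lambda>k. v k \<bullet> y) \<longlongrightarrow> x \<bullet> y) G"
      using bounded_weak_cluster_point[of F v B] B by blast
    have "G \<le> sequentially" using G(2) by (simp add: F_def)
    with unique G(1) x have "x = l" by blast
    then have "eventually (\<lambda>k. v k \<bullet> y \<in> S) G"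
      using x[of y] S by (simp add: tendsto_def)
    moreover have "eventually (\<lambda>k. v k \<bullet> y \<notin> S) G"
      using G(2) by (rule filter_leD) (simp add: F_def eventually_inf_principal)
    ultimately have "eventually (\<lambda>_. False) G" by (rule eventually_elim2) blast
    with G(1) show False by (simp add: trivial_limit_def)
  qed
  then show ?thesis by (simp add: weakly_converges_iff_inner)
qed

section \<open>Maximal monotone operators\<close>

text \<open>
  The usual working form of maximality: adding a point monotonically related to the graph
  gives a monotone extension, so the point was already there.
\<close>

lemma maximal_monotone_memI:
  assumes max: "maximal_monotone A"
    and related: "\<And>y q. q \<in> A y \<Longrightarrow> (x - y) \<bullet> (p - q) \<ge> 0"
  shows "p \<in> A x"
proof -
  define B where "B = A(x := insert p (A x))"
  have related': "(y - x) \<bullet> (q - p) \<ge> 0" if "q \<in> A y" for y q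
    using related[OF that] by (simp add: inner_diff algebra_simps)
  have mono: "(y - z) \<bullet> (q - r) \<ge> 0" if "q \<in> A y" "r \<in> A z" for y z q r
    using max that by (auto simp: maximal_monotone_def monotone_operator_def)
  have "monotone_operator B"
    unfolding monotone_operator_def B_def
    using related related' mono by (auto split: if_splits)
  moreover have "op_graph A \<subseteq> op_graph B"
    by (auto simp: op_graph_def B_def)
  ultimately have "op_graph B = op_graph A"
    using max by (simp add: maximal_monotone_def)
  moreover have "(x, p) \<in> op_graph B" by (simp add: op_graph_def B_def)
  ultimately show ?thesis by (simp add: op_graph_def)
qed

text \<open>
  Monotonicity against a given point \<open>(y, q)\<close> of the graph passes to the limit: the one product of
  two varying factors, \<open>v i \<bullet> r i\<close>, converges because \<open>v\<close> is bounded and \<open>r\<close> converges in norm.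
  The limit inequality and maximality put \<open>(x, p)\<close> into the graph.
\<close>

lemma maximal_monotone_demiclosed:
  fixes A :: "'a::real_inner setop"
  assumes max: "maximal_monotone A" and "G \<noteq> bot"
    and graph: "\<And>i. r i \<in> A (v i)"
    and B: "\<And>i. norm (v i) \<le> B"
    and v: "\<And>y. ((\<lambda>i. v i \<bullet> y) \<longlongrightarrow> x \<bullet> y) G"
    and r: "(r \<longlongrightarrow> p) G"
  shows "p \<in> A x"
proof (rule maximal_monotone_memI[OF max])
  fix y q
  assume q: "q \<in> A y"
  have mono: "0 \<le> (v i - y) \<bullet> (r i - q)" for i
    using max graph[of i] q by (auto simp: maximal_monotone_def monotone_operator_def)
  have "((\<lambda>i. norm (r i - p)) \<longlongrightarrow> 0) G"
    using r by (simp add: tendsto_norm_zero_iff LIM_zero_iff)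
  then have "((\<lambda>i. B * norm (r i - p)) \<longlongrightarrow> 0) G"
    by (rule tendsto_mult_right_zero)
  then have "((\<lambda>i. v i \<bullet> (r i - p)) \<longlongrightarrow> 0) G"
  proof (rule Lim_null_comparison[rotated])
    have "norm (v i \<bullet> (r i - p)) \<le> B * norm (r i - p)" for i
      using Cauchy_Schwarz_ineq2[of "v i" "r i - p"]
        mult_right_mono[OF B[of i], of "norm (r i - p)"] by simp
    then show "\<forall>\<^sub>F i in G. norm (v i \<bullet> (r i - p)) \<le> B * norm (r i - p)" by simp
  qed
  then have "((\<lambda>i. v i \<bullet> (r i - p) + v i \<bullet> (p - q) - y \<bullet> (r i - q)) \<longlongrightarrow>
      0 + x \<bullet> (p - q) - y \<bullet> (p - q)) G"
    by (intro tendsto_intros v r)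
  moreover have "v i \<bullet> (r i - p) + v i \<bullet> (p - q) - y \<bullet> (r i - q) = (v i - y) \<bullet> (r i - q)" for i
    by (simp add: inner_diff)
  ultimately have "((\<lambda>i. (v i - y) \<bullet> (r i - q)) \<longlongrightarrow> (x - y) \<bullet> (p - q)) G"
    by (simp add: inner_diff_left[of x y])
  then show "0 \<le> (x - y) \<bullet> (p - q)"
    by (rule tendsto_lowerbound) (use mono \<open>G \<noteq> bot\<close> in auto)
qed

section \<open>The degenerate preconditioner\<close>

text \<open>
  Although the seminorm may vanish on nonzero vectors, it controls the norm of \<open>M x\<close>, with
  constant \<open>sqrt B\<close> for any bound \<open>B\<close> on \<open>M\<close>. This follows from positivity of \<open>M\<close> at a point
  on the line from \<open>x\<close> in the direction \<open>- M x\<close>, without a square root of the operator.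
\<close>

lemma norm_psd_le_M_seminorm:
  fixes M :: "'a::real_inner \<Rightarrow> 'a"
  assumes "bounded_linear M" and sym: "\<And>x y. x \<bullet> M y = M x \<bullet> y" and psd: "\<And>x. x \<bullet> M x \<ge> 0"
  obtains K where "K \<ge> 0" "\<And>x. norm (M x) \<le> K * M_seminorm M x"
proof -
  interpret bounded_linear M by fact
  obtain B where "B > 0" and B: "\<And>x. norm (M x) \<le> norm x * B"
    using pos_bounded by auto
  have "norm (M x) \<le> sqrt B * M_seminorm M x" for x
  proof -
    define n where "n = M x \<bullet> M x"
    have MM: "M x \<bullet> M (M x) \<le> B * n"
    proof -
      have "M x \<bullet> M (M x) \<le> norm (M x) * norm (M (M x))" by (rule norm_cauchy_schwarz)
      also have "\<dots> \<le> norm (M x) * (norm (M x) * B)"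
        by (rule mult_left_mono[OF B]) simp
      finally show ?thesis
        by (simp add: n_def power2_norm_eq_inner[symmetric] power2_eq_square mult_ac)
    qed
    \<comment> \<open>This step length minimises the upper bound \<open>x \<bullet> M x - 2 * t * n + t * t * (B * n)\<close>.\<close>
    define t where "t = inverse B"
    have "0 \<le> (x - t *\<^sub>R M x) \<bullet> M (x - t *\<^sub>R M x)" by (rule psd)
    also have "\<dots> = x \<bullet> M x - 2 * t * n + t * t * (M x \<bullet> M (M x))"
      by (simp add: diff scale inner_diff sym[of x "M x"] n_def inner_commute algebra_simps)
    also have "\<dots> \<le> x \<bullet> M x - 2 * t * n + t * t * (B * n)"
      using mult_left_mono[OF MM, of "t * t"] by simp
    also have "\<dots> = x \<bullet> M x - n / B"
      using \<open>B > 0\<close> by (simp add: t_def field_simps)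
    finally have "n \<le> B * (x \<bullet> M x)"
      using \<open>B > 0\<close> by (simp add: field_simps)
    then have "sqrt n \<le> sqrt (B * (x \<bullet> M x))" by simp
    then show ?thesis
      by (simp add: n_def norm_eq_sqrt_inner M_seminorm_def real_sqrt_mult)
  qed
  then show thesis using that[of "sqrt B"] \<open>B > 0\<close> by simp
qed

lemma zer_subset_Fix_resolvent:
  assumes "linear M"
    and single: "\<And>x. resolvent (precond M A) x = {resolvent_map M A x}"
  shows "zer A \<subseteq> Fix (resolvent_map M A)"
proof
  fix a assume "a \<in> zer A"
  then have "a \<in> resolvent (precond M A) a"
    by (auto simp: zer_def resolvent_def precond_def op_inverse_def op_plus_def op_of_def
        linear_0[OF assms(1)])
  then show "a \<in> Fix (resolvent_map M A)" by (simp add: single Fix_def)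
qed

text \<open>
  The polarisation step of Opial's argument: the quadratic terms in \<open>u k\<close> cancel in the difference
  of the squared seminorms of \<open>u k - y\<close> and \<open>u k - x\<close>, and what remains is, up to constants,
  \<open>2 * (u k \<bullet> M (x - y))\<close>.
\<close>

lemma convergent_inner_M_diff:
  fixes M :: "'a::real_inner \<Rightarrow> 'a"
  assumes "linear M" and sym: "\<And>x y. x \<bullet> M y = M x \<bullet> y" and psd: "\<And>x. x \<bullet> M x \<ge> 0"
    and conv: "convergent (\<lambda>k. M_seminorm M (u k - x))" "convergent (\<lambda>k. M_seminorm M (u k - y))"
  shows "convergent (\<lambda>k. u k \<bullet> M (x - y))"
proof -
  obtain a b where ab: "(\<lambda>k. M_seminorm M (u k - x)) \<longlonglongrightarrow> a" "(\<lambda>k. M_seminorm M (u k - y)) \<longlonglongrightarrow> b"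
    using conv by (auto simp: convergent_def)
  have "(\<lambda>k. ((M_seminorm M (u k - y))\<^sup>2 - (M_seminorm M (u k - x))\<^sup>2 - y \<bullet> M y + x \<bullet> M x) / 2)
      \<longlonglongrightarrow> (b\<^sup>2 - a\<^sup>2 - y \<bullet> M y + x \<bullet> M x) / 2"
    by (intro tendsto_intros ab) simp
  moreover have "((M_seminorm M (z - y))\<^sup>2 - (M_seminorm M (z - x))\<^sup>2 - y \<bullet> M y + x \<bullet> M x) / 2
      = z \<bullet> M (x - y)" for z
  proof -
    have square: "(M_seminorm M (z - w))\<^sup>2 = z \<bullet> M z - 2 * (z \<bullet> M w) + w \<bullet> M w" for w
      using sym[of w z]
      by (simp add: M_seminorm_def psd)
        (simp add: linear_diff[OF assms(1)] inner_diff inner_commute)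
    show ?thesis by (simp add: square linear_diff[OF assms(1)] inner_diff field_simps)
  qed
  ultimately show ?thesis by (auto simp: convergent_def)
qed

lemma zer_adj_pushforward: "zer (adj_pushforward C A) = adjoint C ` zer A" if "linear C"
  using linear_0[OF that]
  by (auto simp: zer_def adj_pushforward_def op_inverse_def)

section \<open>Opial's argument in the seminorm\<close>

theorem lemma4p4:
  fixes A :: "'h::{real_inner, complete_space} \<Rightarrow> 'h set"
    and M :: "'h \<Rightarrow> 'h"
    and u :: "nat \<Rightarrow> 'h"
  assumes "maximal_monotone A"
    and "zer A \<noteq> {}"
    and "bounded_linear M"
    and "adjoint M = M"
    and "\<And>x. x \<bullet> M x \<ge> 0"
    and "op_lipschitz_on (op_inverse (op_plus (op_of M) A)) (range M)"
    and "op_domain (resolvent (precond M A)) = UNIV"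
    and "\<And>ustar. ustar \<in> Fix (resolvent_map M A) \<Longrightarrow>
           convergent (\<lambda>k. M_seminorm M (u k - ustar))"
    and "(\<lambda>k. M_seminorm M (u k - resolvent_map M A (u k))) \<longlonglongrightarrow> 0"
  shows "\<exists>ustar\<in>zer A.
      weakly_converges (\<lambda>k. resolvent_map M A (u k)) ustar \<and>
      (\<forall>C :: 'd::{real_inner, complete_space} \<Rightarrow> 'h.
         closed (range M) \<and> onto_decomposition M C \<longrightarrow>
         (\<exists>wstar\<in>zer (adj_pushforward C A).
            weakly_converges (\<lambda>k. adjoint C (u k)) wstar \<and>
            (\<forall>k. op_inverse (op_plus A (op_of M)) (C (adjoint C (u k))) =
                 {resolvent_map M A (u k)}) \<and>
            weakly_converges (\<lambda>k. resolvent_map M A (u k)) ustar))"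
proof -
  have linM: "linear M" using assms(3) by (rule bounded_linear.linear)
  have sym: "x \<bullet> M y = M x \<bullet> y" for x y
    using inner_adjoint[OF assms(3), of x y] assms(4) by simp
  define T where "T = resolvent_map M A"
  have single: "resolvent (precond M A) x = {T x}" for x
    unfolding T_def using linM assms(6,7) by (rule resolvent_eq_resolvent_map)
  have inv_plus: "op_inverse (op_plus (op_of M) A) (M x) = {T x}" for x
    using single[of x] by (simp add: resolvent_precond[OF linM])
  have graph: "M (x - T x) \<in> A (T x)" for x
  proof -
    have "T x \<in> resolvent (precond M A) x" by (simp add: single)
    then obtain q where "x = T x + q" "M q \<in> A (T x)"
      by (auto simp: resolvent_def precond_def op_inverse_def op_plus_def op_of_def)
    then show ?thesis by (metis add_diff_cancel_left')
  qed
  obtain L where "L \<ge> 0" and L: "norm (T x - T y) \<le> L * norm (M x - M y)" for x y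
    using assms(6) inv_plus unfolding op_lipschitz_on_def by (metis rangeI singletonI)
  obtain K where "K \<ge> 0" and K: "norm (M x) \<le> K * M_seminorm M x" for x
    using norm_psd_le_M_seminorm[OF assms(3) sym assms(5)] by blast
  have fixed: "T a = a" if "a \<in> zer A" for a
    using zer_subset_Fix_resolvent[OF linM, of A] single that by (auto simp: T_def Fix_def)
  have conv: "convergent (\<lambda>k. M_seminorm M (u k - a))" if "a \<in> zer A" for a
    using assms(8) fixed[OF that] by (simp add: Fix_def T_def)
  define v where "v k = T (u k)" for k
  have seminorm_diff: "(\<lambda>k. M_seminorm M (u k - v k)) \<longlonglongrightarrow> 0"
    using assms(9) by (simp add: v_def T_def)

  \<comment> \<open>\<open>T\<close> turns boundedness in the seminorm into boundedness in norm.\<close>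
  obtain B where B: "\<And>k. norm (v k) \<le> B"
  proof -
    obtain a where a: "a \<in> zer A" using assms(2) by blast
    obtain R where R: "\<And>k. M_seminorm M (u k - a) \<le> R"
      using convergent_imp_Bseq[OF conv[OF a]] by (auto simp: Bseq_def abs_le_iff)
    have "norm (v k) \<le> norm a + L * (K * R)" for k
    proof -
      have "norm (v k - a) \<le> L * norm (M (u k - a))"
        using L[of "u k" a] fixed[OF a] by (simp add: v_def linear_diff[OF linM])
      also have "\<dots> \<le> L * (K * R)"
        using K[of "u k - a"] mult_left_mono[OF R[of k] \<open>K \<ge> 0\<close>] \<open>L \<ge> 0\<close>
        by (intro mult_left_mono) auto
      finally show ?thesis using norm_triangle_sub[of "v k" a] by linarith
    qed
    then show thesis by (rule that)
  qed

  have residual: "(\<lambda>k. M (u k - v k)) \<longlonglongrightarrow> 0"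
  proof (rule Lim_null_comparison)
    show "\<forall>\<^sub>F k in sequentially. norm (M (u k - v k)) \<le> K * M_seminorm M (u k - v k)"
      using K by simp
    show "(\<lambda>k. K * M_seminorm M (u k - v k)) \<longlonglongrightarrow> 0"
      using seminorm_diff by (rule tendsto_mult_right_zero)
  qed

  have cluster_zer: "x \<in> zer A"
    if "G \<noteq> bot" "G \<le> sequentially" "\<And>y. ((\<lambda>k. v k \<bullet> y) \<longlongrightarrow> x \<bullet> y) G" for G x
  proof -
    have "0 \<in> A x"
      by (rule maximal_monotone_demiclosed[OF assms(1) that(1) _ B that(3)
            tendsto_mono[OF that(2) residual]])
        (simp add: v_def graph)
    then show ?thesis by (simp add: zer_def)
  qed

  have cluster_unique: "x = y"
    if F: "F \<noteq> bot" "F \<le> sequentially" "\<And>z. ((\<lambda>k. v k \<bullet> z) \<longlongrightarrow> x \<bullet> z) F"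
      and G: "G \<noteq> bot" "G \<le> sequentially" "\<And>z. ((\<lambda>k. v k \<bullet> z) \<longlongrightarrow> y \<bullet> z) G" for F G x y
  proof -
    have x: "x \<in> zer A" and y: "y \<in> zer A"
      using cluster_zer F G by blast+
    obtain c where "(\<lambda>k. u k \<bullet> M (x - y)) \<longlonglongrightarrow> c"
      using convergent_inner_M_diff[OF linM sym assms(5) conv[OF x] conv[OF y]]
      by (auto simp: convergent_def)
    \<comment> \<open>Pass from \<open>u\<close> to \<open>v\<close>: by symmetry of \<open>M\<close> the difference is an inner product with the residual.\<close>
    then have "(\<lambda>k. u k \<bullet> M (x - y) - M (u k - v k) \<bullet> (x - y)) \<longlonglongrightarrow> c - 0 \<bullet> (x - y)"
      by (intro tendsto_intros residual)
    then have lim: "(\<lambda>k. v k \<bullet> M (x - y)) \<longlonglongrightarrow> c"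
      by (simp add: sym[symmetric] inner_diff_left)
    have "x \<bullet> M (x - y) = c"
      using tendsto_unique[OF F(1) F(3) tendsto_mono[OF F(2) lim]] .
    moreover have "y \<bullet> M (x - y) = c"
      using tendsto_unique[OF G(1) G(3) tendsto_mono[OF G(2) lim]] .
    ultimately have "M_seminorm M (x - y) = 0"
      by (simp add: M_seminorm_def inner_diff_left)
    then have "M x = M y"
      using K[of "x - y"] by (simp add: linear_diff[OF linM])
    then show ?thesis
      using L[of x y] fixed[OF x] fixed[OF y] by simp
  qed

  obtain G l where G: "G \<noteq> bot" "G \<le> sequentially" "\<And>y. ((\<lambda>k. v k \<bullet> y) \<longlongrightarrow> l \<bullet> y) G"
    using bounded_weak_cluster_point[of sequentially v B] B by auto
  have l: "l \<in> zer A" using G by (rule cluster_zer)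
  have weak: "weakly_converges v l"
    using B by (rule weakly_converges_if_unique_cluster_point) (rule cluster_unique[OF _ _ _ G])

  have "\<exists>wstar\<in>zer (adj_pushforward C A).
      weakly_converges (\<lambda>k. adjoint C (u k)) wstar \<and>
      (\<forall>k. op_inverse (op_plus A (op_of M)) (C (adjoint C (u k))) = {T (u k)})"
    if "onto_decomposition M C" for C :: "'d \<Rightarrow> 'h"
  proof (intro bexI conjI allI)
    have C: "bounded_linear C" and M_eq: "\<And>x. M x = C (adjoint C x)"
      using that by (auto simp: onto_decomposition_def)
    have C': "bounded_linear (adjoint C)" using C by (rule bounded_linear_adjoint)
    show "adjoint C l \<in> zer (adj_pushforward C A)"
      using l zer_adj_pushforward[OF bounded_linear.linear[OF C], of A] by blast
    have "norm (adjoint C x) = M_seminorm M x" for x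
      by (simp add: M_seminorm_def M_eq norm_eq_sqrt_inner inner_adjoint[OF C] inner_commute)
    then have "(\<lambda>k. norm (adjoint C (u k - v k))) \<longlonglongrightarrow> 0"
      using seminorm_diff by simp
    then have "(\<lambda>k. adjoint C (u k) - adjoint C (v k)) \<longlonglongrightarrow> 0"
      by (simp add: tendsto_norm_zero_iff linear_diff[OF bounded_linear.linear[OF C']])
    with weakly_converges_bounded_linear[OF C' weak]
    show "weakly_converges (\<lambda>k. adjoint C (u k)) (adjoint C l)"
      by (rule weakly_converges_diff_tendsto_zero)
    have "op_plus A (op_of M) = op_plus (op_of M) A"
      by (auto simp: op_plus_def op_of_def add.commute)
    then show "op_inverse (op_plus A (op_of M)) (C (adjoint C (u k))) = {T (u k)}" for k
      using inv_plus[of "u k"] by (simp add: M_eq)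
  qed
  with l weak show ?thesis unfolding v_def T_def by blast
qed

end
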